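(* Let $C=\mathrm{conv}(A)\subset\mathbb{R}^d$, with $A=\{a_0,a_1,\dots,a_q\}$ finite, be a convex polytope of diameter $\Delta>0$, and let $f\colon\mathbb{R}^d\to\mathbb{R}$ be differentiable with $L$-Lipschitz continuous gradient. Let $\tau>0$ and $\sigma\in[0,1/3)$, and suppose that for every $\bar x\in C$ the estimate $\widetilde\nabla f(\bar x)\in\mathbb{R}^d$ of $\nabla f(\bar x)$ satisfies $$\bigl|(\nabla f(\bar x)-\widetilde\nabla f(\bar x))^\top(x-\bar x)\bigr|\le \frac{\sigma}{1+\sigma}\,\tau\qquad\text{for all }x,\bar x\in C .$$ Let $R\in\mathbb{N}$ and consider the pairwise Frank-Wolfe algorithm with inexact gradient and controlled swaps (described in the context), started at $x_0\in A$ with tolerance $\tau$ and parameter $R$. Suppose that, for some fixed $\rho>0$, its step sizes $\eta_n$ satisfy $$\eta_n\ge\bar\eta_n:=\min\Bigl\{\eta_n^{\max},\frac{\tilde g_n}{L\|d_n\|^2}\Bigr\},\qquad f(x_n)-f(x_n+\eta_nd_n)\ge\rho\,\bar\eta_n\,\tilde g_n .$$ Then the algorithm terminates after a finite number of iterations; specifically, the index $N$ of its last iteration satisfies $$N\le\lceil2(R+1)\max\{\alpha_1,\alpha_2\}\rceil-1,\qquad \alpha_1=\frac{\Delta^2L\,(f(x_0)-f^* )(1+\sigma)^2}{\tau^2\rho(1-\sigma)^2},\qquad \alpha_2=\frac{2\,(f(x_0)-f^* )(1+\sigma)}{\tau(1-3\sigma)} ,$$ and the best Frank-Wolfe gap satisfies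 $$g_N^*\le\frac{\tau}{1+\sigma}.$$
   Context: The problem is $\min_{x\in C}f(x)$, and $f^*=\min_{x\in C}f(x)$. Pairwise Frank-Wolfe algorithm with inexact gradient and controlled swaps. Iterates are kept as explicit convex combinations $x_n=\sum_{j=0}^q w_n^ja_j$ with support $S_n=\{j\in\{0,\dots,q\}: w_n^j>0\}$. Input: $x_0=a_{i_0}\in A$, $\tau>0$, $R\in\mathbb{N}$; set $S_0=\{i_0\}$, $w_0^j=1$ if $j=i_0$ and $w_0^j=0$ otherwise; set the swap counter $r=0$. For $n=0,1,2,\dots$: 1. Compute $\widetilde\nabla f(x_n)$. 2. Let $\hat\imath\in\arg\min_{i\in\{0,\dots,q\}}\widetilde\nabla f(x_n)^\top a_i$ and $h_n=a_{\hat\imath}-x_n$ (inexact FW direction). 3. Let $\hat\jmath\in\arg\max_{j\in S_n}\widetilde\nabla f(x_n)^\top a_j$ and $b_n=x_n-a_{\hat\jmath}$ (inexact away-step direction). 4. Set $d_n=h_n+b_n=a_{\hat\imath}-a_{\hat\jmath}$ and $\eta_n^{\max}=w_n^{\hat\jmath}$, and choose a step size $\eta_n\in(0,\eta_n^{\max}]$. 5. If $\eta_n=\eta_n^{\max}$ and $\hat\imath\notin S_n$ (swap step), increase $r$ by $1$. 6. If $r\le R$ (pairwise step): set $x_{n+1}=x_n+\eta_nd_n$; $w_{n+1}^j=w_n^j$ for $j\notin\{\hat\imath,\hat\jmath\}$, $w_{n+1}^{\hat\imath}=w_n^{\hat\imath}+\eta_n$, $w_{n+1}^{\hat\jmath}=w_n^{\hat\jmath}-\eta_n$.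 7. Otherwise ($r>R$), discard the choice of $d_n,\eta_n^{\max},\eta_n$ of step 4 and perform an away-step Frank-Wolfe iteration: if $-\widetilde\nabla f(x_n)^\top h_n\ge-\widetilde\nabla f(x_n)^\top b_n$, set $d_n=h_n$ and $\eta_n^{\max}=1$; else set $d_n=b_n$ and $\eta_n^{\max}=w_n^{\hat\jmath}/(1-w_n^{\hat\jmath})$. Choose $\eta_n\in(0,\eta_n^{\max}]$ and set $x_{n+1}=x_n+\eta_nd_n$. If $d_n=h_n$ was selected: $w_{n+1}^j=(1-\eta_n)w_n^j$ for $j\ne\hat\imath$ and $w_{n+1}^{\hat\imath}=(1-\eta_n)w_n^{\hat\imath}+\eta_n$; if $d_n=b_n$ was selected: $w_{n+1}^j=(1+\eta_n)w_n^j$ for $j\ne\hat\jmath$ and $w_{n+1}^{\hat\jmath}=(1+\eta_n)w_n^{\hat\jmath}-\eta_n$. Reset $r=0$. 8. Set $S_{n+1}=\{j: w_{n+1}^j>0\}$. Stop after this iteration if $-\widetilde\nabla f(x_n)^\top h_n\le\tau$. Upon stopping, $N$ denotes the index $n$ of the last iteration performed (iterations are numbered from $0$). In the step size conditions, $d_n$, $\eta_n^{\max}$, $\eta_n$ are those actually used to form $x_{n+1}$. Notation: $\tilde g_n=-\widetilde\nabla f(x_n)^\top d_n$. The (exact) Frank-Wolfe gap is $g_n^{FW}=-\min_{x\in C}\nabla f(x_n)^\top(x-x_n)\ge0$, and the best Frank-Wolfe gap along iterations $0,\dots,N$ is $g_N^*=\min_{0\le i\le N}g_i^{FW}$.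
   Formalization: The gap bound at N fails for σ>0; proved instead: g_N^* ≤ τ(1+2σ)/(1+σ), and g_K^* ≤ τ/(1+σ) for any K ≥ the iteration bound if iterations 0..K are valid, ignoring the stop test. If f(x_0)=f^* the bound on N would be -1; N=0 is proved instead. L>0 is assumed. *)

theory Defs
  imports "HOL-Analysis.Analysis"
begin

text \<open>
  The polytope is the convex hull of \<open>a 0, \<dots>, a q\<close>, and \<open>G\<close> is the inexact gradient.
  A trace records the quantities of every iteration of the algorithm. The fields
  \<open>dir\<close>, \<open>max_step\<close> and \<open>step\<close> hold the values actually used to form the next
  iterate, that is, those of the away-step Frank-Wolfe iteration whenever the pairwise choice has
  been discarded. Entries after the last iteration performed carry no meaning.
\<close>

record 'a pfw_trace =
  iter :: "nat \<Rightarrow> 'a"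
  weight :: "nat \<Rightarrow> nat \<Rightarrow> real"
  swap_count :: "nat \<Rightarrow> nat"
  fw_index :: "nat \<Rightarrow> nat"
  away_index :: "nat \<Rightarrow> nat"
  dir :: "nat \<Rightarrow> 'a"
  max_step :: "nat \<Rightarrow> real"
  step :: "nat \<Rightarrow> real"

definition support :: "nat \<Rightarrow> 'a pfw_trace \<Rightarrow> nat \<Rightarrow> nat set" where
  "support q T n = {j. j \<le> q \<and> weight T n j > 0}"

definition fw_dir :: "(nat \<Rightarrow> 'a::euclidean_space) \<Rightarrow> 'a pfw_trace \<Rightarrow> nat \<Rightarrow> 'a" where
  "fw_dir a T n = a (fw_index T n) - iter T n"

definition away_dir :: "(nat \<Rightarrow> 'a::euclidean_space) \<Rightarrow> 'a pfw_trace \<Rightarrow> nat \<Rightarrow> 'a" where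
  "away_dir a T n = iter T n - a (away_index T n)"

definition pfw_init :: "(nat \<Rightarrow> 'a::euclidean_space) \<Rightarrow> nat \<Rightarrow> 'a pfw_trace \<Rightarrow> bool" where
  "pfw_init a q T \<longleftrightarrow>
     (\<exists>i0\<le>q. iter T 0 = a i0 \<and> (\<forall>k\<le>q. weight T 0 k = (if k = i0 then 1 else 0))) \<and>
     swap_count T 0 = 0"

text \<open>
  When the two selected indices coincide, the direction vanishes and the weights stay unchanged;
  hence the pairwise update adds and subtracts the step instead of assigning two values.
\<close>

definition pairwise_move :: "(nat \<Rightarrow> 'a::euclidean_space) \<Rightarrow> nat \<Rightarrow> 'a pfw_trace \<Rightarrow> nat \<Rightarrow> bool" where
  "pairwise_move a q T n \<longleftrightarrow>
     dir T n = fw_dir a T n + away_dir a T n \<and>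
     max_step T n = weight T n (away_index T n) \<and>
     (\<forall>k\<le>q. weight T (Suc n) k = weight T n k
        + (if k = fw_index T n then step T n else 0)
        - (if k = away_index T n then step T n else 0))"

text \<open>
  The division by zero in the away branch is never reached: if the away vertex has weight one,
  the iterate is that vertex and the away direction vanishes, so the first branch is taken.
\<close>

definition away_step_move ::
    "(nat \<Rightarrow> 'a::euclidean_space) \<Rightarrow> nat \<Rightarrow> ('a \<Rightarrow> 'a) \<Rightarrow> 'a pfw_trace \<Rightarrow> nat \<Rightarrow> bool" where
  "away_step_move a q G T n \<longleftrightarrow>
     0 < step T n \<and> step T n \<le> max_step T n \<and>
     (if - (G (iter T n) \<bullet> fw_dir a T n) \<ge> - (G (iter T n) \<bullet> away_dir a T n)
      then dir T n = fw_dir a T n \<and> max_step T n = 1 \<and>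
           (\<forall>k\<le>q. weight T (Suc n) k = (1 - step T n) * weight T n k
              + (if k = fw_index T n then step T n else 0))
      else dir T n = away_dir a T n \<and>
           max_step T n = weight T n (away_index T n) / (1 - weight T n (away_index T n)) \<and>
           (\<forall>k\<le>q. weight T (Suc n) k = (1 + step T n) * weight T n k
              - (if k = away_index T n then step T n else 0)))"

text \<open>
  The variable \<open>\<eta>\<close> is the step size chosen for the pairwise direction. It decides whether the
  iteration counts as a swap, and it is the step taken exactly when the counter does not exceed
  \<open>R\<close>.
\<close>

definition pfw_iteration ::
    "(nat \<Rightarrow> 'a::euclidean_space) \<Rightarrow> nat \<Rightarrow> ('a \<Rightarrow> 'a) \<Rightarrow> nat \<Rightarrow> 'a pfw_trace \<Rightarrow> nat \<Rightarrow> bool" where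
  "pfw_iteration a q G R T n \<longleftrightarrow>
     is_arg_min (\<lambda>i. G (iter T n) \<bullet> a i) (\<lambda>i. i \<le> q) (fw_index T n) \<and>
     is_arg_max (\<lambda>j. G (iter T n) \<bullet> a j) (\<lambda>j. j \<in> support q T n) (away_index T n) \<and>
     iter T (Suc n) = iter T n + step T n *\<^sub>R dir T n \<and>
     (\<exists>\<eta>. 0 < \<eta> \<and> \<eta> \<le> weight T n (away_index T n) \<and>
        (let r = (if \<eta> = weight T n (away_index T n) \<and> fw_index T n \<notin> support q T n
                  then swap_count T n + 1 else swap_count T n)
         in if r \<le> R
            then step T n = \<eta> \<and> pairwise_move a q T n \<and> swap_count T (Suc n) = r
            else away_step_move a q G T n \<and> swap_count T (Suc n) = 0))"

definition pfw_stop ::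
    "(nat \<Rightarrow> 'a::euclidean_space) \<Rightarrow> ('a \<Rightarrow> 'a) \<Rightarrow> real \<Rightarrow> 'a pfw_trace \<Rightarrow> nat \<Rightarrow> bool" where
  "pfw_stop a G \<tau> T n \<longleftrightarrow> - (G (iter T n) \<bullet> fw_dir a T n) \<le> \<tau>"

definition pfw_performed ::
    "(nat \<Rightarrow> 'a::euclidean_space) \<Rightarrow> ('a \<Rightarrow> 'a) \<Rightarrow> real \<Rightarrow> 'a pfw_trace \<Rightarrow> nat \<Rightarrow> bool" where
  "pfw_performed a G \<tau> T n \<longleftrightarrow> (\<forall>m<n. \<not> pfw_stop a G \<tau> T m)"

definition pfw_last ::
    "(nat \<Rightarrow> 'a::euclidean_space) \<Rightarrow> ('a \<Rightarrow> 'a) \<Rightarrow> real \<Rightarrow> 'a pfw_trace \<Rightarrow> nat \<Rightarrow> bool" where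
  "pfw_last a G \<tau> T N \<longleftrightarrow> pfw_performed a G \<tau> T N \<and> pfw_stop a G \<tau> T N"

definition pfw_run ::
    "(nat \<Rightarrow> 'a::euclidean_space) \<Rightarrow> nat \<Rightarrow> ('a \<Rightarrow> 'a) \<Rightarrow> real \<Rightarrow> nat \<Rightarrow> 'a pfw_trace \<Rightarrow> bool" where
  "pfw_run a q G \<tau> R T \<longleftrightarrow>
     pfw_init a q T \<and> (\<forall>n. pfw_performed a G \<tau> T n \<longrightarrow> pfw_iteration a q G R T n)"

text \<open>
  If the direction vanishes, then so does the slope, and the quotient below is \<open>0 / 0 = 0\<close>, so
  that \<open>step_lower\<close> is zero and \<open>step_cond\<close> holds trivially.
\<close>

definition slope :: "('a \<Rightarrow> 'a) \<Rightarrow> 'a::euclidean_space pfw_trace \<Rightarrow> nat \<Rightarrow> real" where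
  "slope G T n = - (G (iter T n) \<bullet> dir T n)"

definition step_lower :: "real \<Rightarrow> ('a \<Rightarrow> 'a) \<Rightarrow> 'a::euclidean_space pfw_trace \<Rightarrow> nat \<Rightarrow> real" where
  "step_lower L G T n = min (max_step T n) (slope G T n / (L * (norm (dir T n))\<^sup>2))"

definition step_cond ::
    "('a \<Rightarrow> real) \<Rightarrow> real \<Rightarrow> real \<Rightarrow> ('a \<Rightarrow> 'a) \<Rightarrow> 'a::euclidean_space pfw_trace \<Rightarrow> nat \<Rightarrow> bool" where
  "step_cond f L \<rho> G T n \<longleftrightarrow>
     step T n \<ge> step_lower L G T n \<and>
     f (iter T n) - f (iter T n + step T n *\<^sub>R dir T n) \<ge> \<rho> * step_lower L G T n * slope G T n"

text \<open>The minimum of a continuous function over a nonempty compact set is written as an infimum.\<close>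

definition fw_gap :: "'a::euclidean_space set \<Rightarrow> ('a \<Rightarrow> 'a) \<Rightarrow> 'a \<Rightarrow> real" where
  "fw_gap C gradf y = - (INF x\<in>C. gradf y \<bullet> (x - y))"

definition best_fw_gap ::
    "'a::euclidean_space set \<Rightarrow> ('a \<Rightarrow> 'a) \<Rightarrow> 'a pfw_trace \<Rightarrow> nat \<Rightarrow> real" where
  "best_fw_gap C gradf T N = Min ((\<lambda>i. fw_gap C gradf (iter T i)) ` {0..N})"

end

theory Submission
  imports Defs
begin

text \<open>
  Call \<open>\<gamma>\<close> the inexact Frank-Wolfe gap, the quantity tested against \<open>\<tau>\<close>; it differs from the
  exact gap by at most \<open>\<epsilon> = \<sigma> \<tau> / (1 + \<sigma>)\<close>. Put \<open>\<theta> = \<tau> / (1 + \<sigma>) - \<epsilon> \<le> \<tau>\<close>. An iteration that does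
  not stop has \<open>\<gamma> > \<tau> \<ge> \<theta>\<close>, and an iteration whose exact gap exceeds \<open>\<tau> / (1 + \<sigma>)\<close> also has
  \<open>\<gamma> > \<theta>\<close>. So both halves of the theorem follow from one bound on the length of an initial stretch
  of iterations with \<open>\<gamma> > \<theta>\<close> (\<open>iteration_bound\<close>).

  On such a stretch the slope is always more than \<open>\<theta>\<close>, and there are two ways to decrease \<open>f\<close> by
  more than a fixed amount \<open>\<delta>\<close>. If the maximal step does not truncate the quotient
  \<open>slope / (L * norm dir ^ 2)\<close>, the assumed decrease is more than \<open>\<rho> \<theta>\<^sup>2 / (L \<Delta>\<^sup>2)\<close>
  (\<open>short_step_decrease\<close>). If a full Frank-Wolfe step is truncated at length one, the descent lemma
  gives more than \<open>\<theta> / 2 - \<epsilon>\<close> (\<open>full_fw_step_decrease\<close>); this is positive because \<open>\<sigma> < 1 / 3\<close>. Dividing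
  \<open>f (x 0) - fstar\<close> by these two amounts gives \<open>\<alpha>1\<close> and \<open>\<alpha>2\<close>; \<open>\<delta>\<close> is the smaller amount.

  Every other iteration removes the away vertex with a truncated step. Either the support shrinks (a
  drop), or the removed vertex is replaced by a new one and the swap counter grows (a swap). A swap of
  this kind needs at least two active vertices, because a maximal pairwise step taken at a vertex is
  a full Frank-Wolfe step and hence productive (\<open>iteration_progress\<close>).

  It remains to charge the unproductive iterations to the productive ones. From support size \<open>s\<close> and
  counter \<open>r\<close> at most \<open>(s - 1) * (R + 1) - r\<close> unproductive iterations can follow one another, since
  each of the \<open>s - 1\<close> possible drops is preceded by at most \<open>R\<close> swaps. The run starts at a vertex,
  with budget zero.
  A productive iteration adds at most one active vertex and forgets at most \<open>R\<close> counted swaps, so it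
  is responsible for at most \<open>2 * (R + 1)\<close> iterations, itself included (\<open>potential_bound\<close>). As
  \<open>f (x 0) - fstar\<close> allows fewer than \<open>(f (x 0) - fstar) / \<delta> = max \<alpha>1 \<alpha>2\<close> productive iterations
  once there is one, the bound on the number of iterations is strict.
\<close>

section \<open>Smooth functions and linear functions on a polytope\<close>

text \<open>
  Subtracting the linear and quadratic terms from \<open>f\<close> along the segment leaves a function of one real
  variable whose derivative is nonpositive by the Lipschitz bound and the Cauchy-Schwarz inequality.
\<close>

lemma descent_lemma:
  fixes f :: "'a::real_inner \<Rightarrow> real"
  assumes grad: "\<And>x. GDERIV f x :> gradf x"
    and lip: "L-lipschitz_on UNIV gradf"
  shows "f (x + d) \<le> f x + gradf x \<bullet> d + L / 2 * (norm d)\<^sup>2"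
proof -
  define \<phi> where "\<phi> t = f (x + t *\<^sub>R d) - t * (gradf x \<bullet> d) - L / 2 * t\<^sup>2 * (norm d)\<^sup>2" for t :: real
  define \<phi>' where "\<phi>' t = gradf (x + t *\<^sub>R d) \<bullet> d - gradf x \<bullet> d - L * t * (norm d)\<^sup>2" for t :: real
  have deriv: "(\<phi> has_real_derivative \<phi>' t) (at t)" for t
  proof -
    have "(f has_derivative (\<lambda>h. h \<bullet> gradf (x + t *\<^sub>R d))) (at (x + t *\<^sub>R d))"
      using grad[of "x + t *\<^sub>R d"] by (simp add: gderiv_def)
    moreover have "((\<lambda>s. x + s *\<^sub>R d) has_derivative (\<lambda>h. h *\<^sub>R d)) (at t)"
      by (auto intro!: derivative_eq_intros)
    ultimately have "((\<lambda>s. f (x + s *\<^sub>R d)) has_derivative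
        (\<lambda>h. (h *\<^sub>R d) \<bullet> gradf (x + t *\<^sub>R d))) (at t)"
      by (rule has_derivative_compose[rotated])
    then have "((\<lambda>s. f (x + s *\<^sub>R d)) has_real_derivative gradf (x + t *\<^sub>R d) \<bullet> d) (at t)"
      by (simp add: has_field_derivative_def inner_commute mult.commute[of _ "gradf _ \<bullet> d"] mult_commute_abs)
    then show ?thesis
      unfolding \<phi>_def \<phi>'_def
      by (auto intro!: derivative_eq_intros simp: algebra_simps)
  qed
  have nonpos: "\<phi>' t \<le> 0" if "0 \<le> t" for t
  proof -
    have "gradf (x + t *\<^sub>R d) \<bullet> d - gradf x \<bullet> d = (gradf (x + t *\<^sub>R d) - gradf x) \<bullet> d"
      by (simp add: inner_diff_left)
    also have "\<dots> \<le> norm (gradf (x + t *\<^sub>R d) - gradf x) * norm d"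
      by (rule norm_cauchy_schwarz)
    also have "\<dots> \<le> (L * norm (t *\<^sub>R d)) * norm d"
      using lipschitz_onD[OF lip, of "x + t *\<^sub>R d" x]
      by (intro mult_right_mono) (auto simp: dist_norm)
    also have "\<dots> = L * t * (norm d)\<^sup>2"
      using that by (simp add: power2_eq_square)
    finally show ?thesis by (simp add: \<phi>'_def)
  qed
  have "\<phi> 1 \<le> \<phi> 0"
    by (rule DERIV_nonpos_imp_nonincreasing) (use deriv nonpos in auto)
  then show ?thesis by (simp add: \<phi>_def)
qed

lemma inner_min_on_convex_hull:
  fixes v :: "'a::real_inner"
  assumes "\<And>y. y \<in> V \<Longrightarrow> m \<le> v \<bullet> y" and "x \<in> convex hull V"
  shows "m \<le> v \<bullet> x"
proof -
  have "convex hull V \<subseteq> {y. v \<bullet> y \<ge> m}"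
    by (rule hull_minimal) (use assms(1) in \<open>auto intro: convex_halfspace_ge\<close>)
  then show ?thesis using assms(2) by auto
qed

section \<open>Iterates as convex combinations\<close>

definition convex_state :: "(nat \<Rightarrow> 'a::euclidean_space) \<Rightarrow> nat \<Rightarrow> 'a pfw_trace \<Rightarrow> nat \<Rightarrow> bool" where
  "convex_state a q T n \<longleftrightarrow>
     (\<forall>k\<le>q. 0 \<le> weight T n k) \<and> (\<Sum>k\<le>q. weight T n k) = 1 \<and>
     iter T n = (\<Sum>k\<le>q. weight T n k *\<^sub>R a k)"

lemma finite_support [simp]: "finite (support q T n)"
  by (simp add: support_def)

lemma convex_state_init: "pfw_init a q T \<Longrightarrow> convex_state a q T 0"
  unfolding pfw_init_def convex_state_def
  by (auto simp: if_distrib[of "\<lambda>c. c *\<^sub>R _"] cong: if_cong)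

lemma card_support_init: "pfw_init a q T \<Longrightarrow> card (support q T 0) = 1"
proof -
  assume "pfw_init a q T"
  then obtain i0 where "i0 \<le> q" and "\<forall>k\<le>q. weight T 0 k = (if k = i0 then 1 else 0)"
    by (auto simp: pfw_init_def)
  then have "support q T 0 = {i0}"
    by (auto simp: support_def split: if_splits)
  then show ?thesis by simp
qed

lemma convex_state_in_hull:
  assumes "convex_state a q T n"
  shows "iter T n \<in> convex hull (a ` {0..q})"
proof -
  have "(\<Sum>k\<le>q. weight T n k *\<^sub>R a k) \<in> convex hull (a ` {0..q})"
    using assms by (intro convex_sum) (auto simp: convex_state_def intro!: hull_inc)
  then show ?thesis using assms by (simp add: convex_state_def)
qed

lemma sum_over_support:
  assumes "convex_state a q T n"
  shows "(\<Sum>k\<in>support q T n. weight T n k) = 1"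
    and "iter T n = (\<Sum>k\<in>support q T n. weight T n k *\<^sub>R a k)"
proof -
  have zero: "\<forall>k\<in>{..q} - support q T n. weight T n k = 0"
    using assms by (force simp: convex_state_def support_def)
  have sub: "support q T n \<subseteq> {..q}"
    by (auto simp: support_def)
  show "(\<Sum>k\<in>support q T n. weight T n k) = 1"
    using assms sum.mono_neutral_left[OF _ sub, of "weight T n"] zero
    by (simp add: convex_state_def)
  show "iter T n = (\<Sum>k\<in>support q T n. weight T n k *\<^sub>R a k)"
    using assms sum.mono_neutral_left[OF _ sub, of "\<lambda>k. weight T n k *\<^sub>R a k"] zero
    by (simp add: convex_state_def)
qed

lemma card_support_pos:
  assumes "convex_state a q T n"
  shows "1 \<le> card (support q T n)"
proof -
  have "support q T n \<noteq> {}"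
    using sum_over_support(1)[OF assms] by auto
  then show ?thesis by (simp add: Suc_le_eq card_gt_0_iff)
qed

lemma weight_le_1:
  assumes "convex_state a q T n" and "k \<in> support q T n"
  shows "weight T n k \<le> 1"
  using member_le_sum[OF assms(2), of "weight T n"] sum_over_support(1)[OF assms(1)]
  by (auto simp: support_def)

lemma singleton_support:
  assumes "convex_state a q T n" and "k \<in> support q T n" and "card (support q T n) \<le> 1"
  shows "weight T n k = 1" and "iter T n = a k"
proof -
  have "support q T n = {k}"
    using assms(2,3) card_support_pos[OF assms(1)]
    by (metis card_1_singletonE le_antisym singletonD)
  then show "weight T n k = 1" and "iter T n = a k"
    using sum_over_support[OF assms(1)] by auto
qed

lemma iter_inner_le_away:
  assumes "convex_state a q T n"
    and "\<And>k. k \<in> support q T n \<Longrightarrow> v \<bullet> a k \<le> m"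
  shows "v \<bullet> iter T n \<le> m"
proof -
  have "v \<bullet> iter T n = (\<Sum>k\<in>support q T n. weight T n k * (v \<bullet> a k))"
    by (subst sum_over_support(2)[OF assms(1)]) (simp add: inner_sum_right)
  also have "\<dots> \<le> (\<Sum>k\<in>support q T n. weight T n k * m)"
    by (intro sum_mono mult_left_mono assms(2)) (auto simp: support_def)
  also have "\<dots> = m"
    using sum_over_support(1)[OF assms(1)] by (simp flip: sum_distrib_right)
  finally show ?thesis .
qed

text \<open>
  All three kinds of move scale the weights by \<open>c\<close>, add \<open>u\<close> at one index and remove \<open>v\<close> at another:
  \<open>(c, u, v)\<close> is \<open>(1, \<eta>, \<eta>)\<close> for a pairwise step, \<open>(1 - \<eta>, \<eta>, 0)\<close> for a Frank-Wolfe step and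
  \<open>(1 + \<eta>, 0, \<eta>)\<close> for an away step.
\<close>

lemma convex_state_update:
  assumes st: "convex_state a q T n" and "i \<le> q" "j \<le> q"
    and upd: "\<And>k. k \<le> q \<Longrightarrow> weight T (Suc n) k
       = c * weight T n k + (if k = i then u else 0) - (if k = j then v else 0)"
    and bal: "c + u - v = 1" and nonneg: "0 \<le> c" "0 \<le> u" "v \<le> c * weight T n j"
    and iter: "iter T (Suc n) = c *\<^sub>R iter T n + u *\<^sub>R a i - v *\<^sub>R a j"
  shows "convex_state a q T (Suc n)"
proof -
  have "0 \<le> weight T (Suc n) k" if "k \<le> q" for k
    using st nonneg that by (auto simp: upd convex_state_def)
  moreover have "(\<Sum>k\<le>q. weight T (Suc n) k) = c * (\<Sum>k\<le>q. weight T n k) + u - v"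
    using \<open>i \<le> q\<close> \<open>j \<le> q\<close>
    by (simp add: upd sum.distrib sum_subtractf sum_distrib_left)
  moreover have "(\<Sum>k\<le>q. weight T (Suc n) k *\<^sub>R a k) =
      (\<Sum>k\<le>q. c *\<^sub>R (weight T n k *\<^sub>R a k) + (if k = i then u *\<^sub>R a k else 0) - (if k = j then v *\<^sub>R a k else 0))"
    by (intro sum.cong) (auto simp: upd algebra_simps)
  then have "(\<Sum>k\<le>q. weight T (Suc n) k *\<^sub>R a k) =
      c *\<^sub>R (\<Sum>k\<le>q. weight T n k *\<^sub>R a k) + u *\<^sub>R a i - v *\<^sub>R a j"
    using \<open>i \<le> q\<close> \<open>j \<le> q\<close>
    by (simp add: sum.distrib sum_subtractf scaleR_sum_right)
  ultimately show ?thesis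
    using st bal by (simp add: convex_state_def iter)
qed

lemma support_update:
  assumes st: "convex_state a q T n" and "0 \<le> v"
    and upd: "\<And>k. k \<le> q \<Longrightarrow> weight T (Suc n) k
       = c * weight T n k + (if k = i then u else 0) - (if k = j then v else 0)"
  shows "support q T (Suc n) \<subseteq> insert i (support q T n)"
proof
  fix k assume "k \<in> support q T (Suc n)"
  then have "k \<le> q" and "0 < weight T (Suc n) k" by (auto simp: support_def)
  then have "k = i \<or> 0 \<noteq> weight T n k"
    using upd[of k] \<open>0 \<le> v\<close> by (auto split: if_splits)
  moreover have "0 \<le> weight T n k"
    using st \<open>k \<le> q\<close> by (simp add: convex_state_def)
  ultimately show "k \<in> insert i (support q T n)"
    using \<open>k \<le> q\<close> by (auto simp: support_def)
qed

section \<open>The budget of unproductive iterations\<close>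

text \<open>
  The largest number of unproductive iterations that can follow one another from support size \<open>s\<close> and
  swap counter \<open>r\<close>: \<open>R - r\<close> swaps and one drop that resets the counter, then \<open>R\<close> swaps and a drop for
  each further vertex, until a single vertex is left, where no unproductive iteration exists.
\<close>

definition bad_budget :: "nat \<Rightarrow> nat \<Rightarrow> nat \<Rightarrow> real" where
  "bad_budget R s r = (if s \<le> 1 then 0 else (real s - 1) * (real R + 1) - real r)"

lemma bad_budget_mono:
  assumes "s' \<le> s" "r \<le> r'" "r \<le> R"
  shows "bad_budget R s' r' \<le> bad_budget R s r"
proof (cases "s' \<le> 1")
  case True
  have "real r \<le> (real s - 1) * (real R + 1)" if "\<not> s \<le> 1"
  proof -
    have "real r \<le> 1 * (real R + 1)"
      using assms(3) by simp
    also have "\<dots> \<le> (real s - 1) * (real R + 1)"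
      using that by (intro mult_right_mono) auto
    finally show ?thesis .
  qed
  then show ?thesis
    using True by (simp add: bad_budget_def)
next
  case False
  have "(real s' - 1) * (real R + 1) \<le> (real s - 1) * (real R + 1)"
    using assms by (intro mult_right_mono) auto
  then have "(real s' - 1) * (real R + 1) - real r' \<le> (real s - 1) * (real R + 1) - real r"
    by (rule diff_mono) (use assms(2) in simp)
  moreover have "\<not> s \<le> 1"
    using False assms(1) by simp
  ultimately show ?thesis
    by (simp only: bad_budget_def False if_False)
qed

lemma bad_budget_nonneg: "r \<le> R \<Longrightarrow> 0 \<le> bad_budget R s r"
  using bad_budget_mono[of 0 s r r R] by (simp add: bad_budget_def)

text \<open>
  The new counter \<open>r'\<close> is arbitrary: in the worst case the drop is an away step that resets it to
  zero, and then the lost vertex pays \<open>R + 1\<close> while the forgotten swaps give back at most \<open>R\<close>.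
\<close>

lemma bad_budget_drop:
  assumes "1 \<le> s'" "s' < s" "r \<le> R"
  shows "bad_budget R s' r' + 1 \<le> bad_budget R s r"
proof -
  have "bad_budget R s' r' \<le> bad_budget R (s - 1) 0"
    using assms by (intro bad_budget_mono) auto
  also have "\<dots> + 1 \<le> bad_budget R s r"
    using assms by (cases "s = 2") (auto simp: bad_budget_def algebra_simps)
  finally show ?thesis by simp
qed

lemma bad_budget_swap:
  assumes "s' \<le> s" "2 \<le> s" "r < R"
  shows "bad_budget R s' (Suc r) + 1 \<le> bad_budget R s r"
proof -
  have "bad_budget R s' (Suc r) \<le> bad_budget R s (Suc r)"
    using assms by (intro bad_budget_mono) auto
  then show ?thesis using assms by (simp add: bad_budget_def)
qed

text \<open>
  A new vertex raises the budget by \<open>R + 1\<close>, a reset of the counter by at most \<open>R\<close>, and the iteration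
  itself counts one.
\<close>

lemma bad_budget_good:
  assumes "1 \<le> s" "s' \<le> s + 1" "r \<le> R"
  shows "bad_budget R s' r' + 1 \<le> bad_budget R s r + 2 * (real R + 1)"
proof -
  have "bad_budget R s' r' \<le> bad_budget R (s + 1) 0"
    using assms by (intro bad_budget_mono) auto
  also have "\<dots> + 1 \<le> bad_budget R s r + 2 * (real R + 1)"
    using assms by (auto simp: bad_budget_def algebra_simps)
  finally show ?thesis by simp
qed

section \<open>Progress of a single iteration\<close>

abbreviation inexact_fw_gap ::
    "(nat \<Rightarrow> 'a::euclidean_space) \<Rightarrow> ('a \<Rightarrow> 'a) \<Rightarrow> 'a pfw_trace \<Rightarrow> nat \<Rightarrow> real" where
  "inexact_fw_gap a G T n \<equiv> - (G (iter T n) \<bullet> fw_dir a T n)"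

text \<open>
  The zero summands in the Frank-Wolfe and away cases bring every weight update to the common form
  of \<open>convex_state_update\<close>.
\<close>

lemma pfw_iteration_cases [consumes 1, case_names pairwise fw away]:
  assumes "pfw_iteration a q G R T n"
  obtains
    "0 < step T n" "step T n \<le> weight T n (away_index T n)"
    "dir T n = a (fw_index T n) - a (away_index T n)"
    "max_step T n = weight T n (away_index T n)"
    "\<And>k. k \<le> q \<Longrightarrow> weight T (Suc n) k = 1 * weight T n k
       + (if k = fw_index T n then step T n else 0) - (if k = away_index T n then step T n else 0)"
    "swap_count T (Suc n) =
       (if step T n = weight T n (away_index T n) \<and> fw_index T n \<notin> support q T n
        then Suc (swap_count T n) else swap_count T n)"
    "swap_count T (Suc n) \<le> R"
  | "0 < step T n" "step T n \<le> 1" "dir T n = fw_dir a T n" "max_step T n = 1"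
    "\<And>k. k \<le> q \<Longrightarrow> weight T (Suc n) k = (1 - step T n) * weight T n k
       + (if k = fw_index T n then step T n else 0) - (if k = away_index T n then 0 else 0)"
    "swap_count T (Suc n) = 0"
  | "0 < step T n" "step T n \<le> max_step T n" "dir T n = away_dir a T n"
    "max_step T n = weight T n (away_index T n) / (1 - weight T n (away_index T n))"
    "inexact_fw_gap a G T n < - (G (iter T n) \<bullet> away_dir a T n)"
    "\<And>k. k \<le> q \<Longrightarrow> weight T (Suc n) k = (1 + step T n) * weight T n k
       + (if k = away_index T n then 0 else 0) - (if k = away_index T n then step T n else 0)"
    "swap_count T (Suc n) = 0"
proof -
  obtain \<eta> r where \<eta>: "0 < \<eta>" "\<eta> \<le> weight T n (away_index T n)"
    and r: "r = (if \<eta> = weight T n (away_index T n) \<and> fw_index T n \<notin> support q T n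
                  then swap_count T n + 1 else swap_count T n)"
    and move: "if r \<le> R
            then step T n = \<eta> \<and> pairwise_move a q T n \<and> swap_count T (Suc n) = r
            else away_step_move a q G T n \<and> swap_count T (Suc n) = 0"
    using assms unfolding pfw_iteration_def Let_def by blast
  show thesis
  proof (cases "r \<le> R")
    case True
    then show thesis
      using move \<eta> r that(1)
      by (simp add: pairwise_move_def fw_dir_def away_dir_def)
  next
    case False
    then have aw: "away_step_move a q G T n" "swap_count T (Suc n) = 0"
      using move by auto
    show thesis
    proof (cases "inexact_fw_gap a G T n \<ge> - (G (iter T n) \<bullet> away_dir a T n)")
      case True
      then show thesis
        using aw that(2) by (simp add: away_step_move_def)
    next
      case False
      then show thesis
        using aw that(3) by (simp add: away_step_move_def)
    qed
  qed
qed

text \<open>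
  The threshold \<open>\<theta>\<close> is a lower bound for the inexact Frank-Wolfe gap during the iterations to be
  counted, and \<open>\<epsilon>\<close> is the error of the inexact gradient along directions of the polytope. A
  Frank-Wolfe step truncated at length one decreases \<open>f\<close> by at least half the gap minus this error, hence \<open>2 * \<epsilon> < \<theta>\<close>.
\<close>

locale inexact_pfw =
  fixes a :: "nat \<Rightarrow> 'a::euclidean_space" and q R :: nat
    and f :: "'a \<Rightarrow> real" and gradf G :: "'a \<Rightarrow> 'a"
    and \<Delta> L \<rho> \<epsilon> \<theta> :: real
    and T :: "'a pfw_trace"
  assumes diam: "\<Delta> = diameter (convex hull (a ` {0..q}))" "0 < \<Delta>"
    and grad: "\<And>x. GDERIV f x :> gradf x"
    and L: "0 < L" "L-lipschitz_on UNIV gradf"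
    and \<rho>: "0 < \<rho>"
    and inexact: "\<And>y x. y \<in> convex hull (a ` {0..q}) \<Longrightarrow> x \<in> convex hull (a ` {0..q}) \<Longrightarrow>
          \<bar>(gradf y - G y) \<bullet> (x - y)\<bar> \<le> \<epsilon>"
    and \<theta>: "0 < \<theta>" "2 * \<epsilon> < \<theta>"
    and init: "pfw_init a q T"
begin

abbreviation C :: "'a set" where "C \<equiv> convex hull (a ` {0..q})"

abbreviation active :: "nat \<Rightarrow> nat" where "active n \<equiv> card (support q T n)"

definition \<delta> :: real where
  "\<delta> = min (\<rho> * \<theta>\<^sup>2 / (L * \<Delta>\<^sup>2)) (\<theta> / 2 - \<epsilon>)"

lemma \<delta>_pos: "0 < \<delta>"
  using diam(2) \<rho> L(1) \<theta> by (simp add: \<delta>_def)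

lemma compact_C: "compact C"
  by (intro compact_convex_hull finite_imp_compact) auto

lemma vertex_in_C: "i \<le> q \<Longrightarrow> a i \<in> C"
  by (auto intro!: hull_inc)

lemma norm_le_diam: "x \<in> C \<Longrightarrow> y \<in> C \<Longrightarrow> norm (x - y) \<le> \<Delta>"
  using diameter_bounded_bound[OF compact_imp_bounded[OF compact_C]] diam(1)
  by (simp add: dist_norm)

text \<open>
  The index chosen by the algorithm minimizes the inexact linear model over the vertices, hence over
  the whole polytope, and exchanging the gradients costs at most \<open>\<epsilon>\<close> at every point.
\<close>

lemma fw_gap_le_inexact_fw_gap:
  assumes "pfw_iteration a q G R T n" and x: "iter T n \<in> C"
  shows "fw_gap C gradf (iter T n) \<le> inexact_fw_gap a G T n + \<epsilon>"
proof -
  have "- inexact_fw_gap a G T n - \<epsilon> \<le> gradf (iter T n) \<bullet> (z - iter T n)" if z: "z \<in> C" for z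
  proof -
    have "G (iter T n) \<bullet> a (fw_index T n) \<le> G (iter T n) \<bullet> z"
      by (rule inner_min_on_convex_hull[OF _ z])
         (use assms(1) in \<open>auto simp: pfw_iteration_def is_arg_min_linorder\<close>)
    then show ?thesis
      using inexact[OF x z] by (simp add: fw_dir_def inner_diff_left inner_diff_right)
  qed
  moreover have "C \<noteq> {}" using x by auto
  ultimately have "- inexact_fw_gap a G T n - \<epsilon> \<le> (INF z\<in>C. gradf (iter T n) \<bullet> (z - iter T n))"
    by (intro cINF_greatest)
  then show ?thesis by (simp add: fw_gap_def)
qed

lemma short_step_decrease:
  assumes sc: "step_cond f L \<rho> G T n" and it: "pfw_iteration a q G R T n"
    and slope: "\<theta> < slope G T n" and norm: "norm (dir T n) \<le> \<Delta>"
    and short: "slope G T n / (L * (norm (dir T n))\<^sup>2) \<le> max_step T n"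
  shows "\<delta> < f (iter T n) - f (iter T (Suc n))"
proof -
  let ?g = "slope G T n" and ?d = "norm (dir T n)"
  have d: "0 < ?d"
    using slope \<theta> by (auto simp: slope_def)
  have "\<delta> \<le> \<rho> * \<theta>\<^sup>2 / (L * \<Delta>\<^sup>2)" by (simp add: \<delta>_def)
  also have "\<dots> < \<rho> * ?g\<^sup>2 / (L * \<Delta>\<^sup>2)"
    using slope \<theta> \<rho> L diam
    by (intro divide_strict_right_mono mult_strict_left_mono power_strict_mono) auto
  also have "\<dots> \<le> \<rho> * ?g\<^sup>2 / (L * ?d\<^sup>2)"
    using \<rho> L d norm by (intro divide_left_mono mult_left_mono power_mono mult_pos_pos) auto
  also have "\<dots> = \<rho> * step_lower L G T n * ?g"
    using short by (simp add: step_lower_def power2_eq_square[of ?g])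
  also have "\<dots> \<le> f (iter T n) - f (iter T (Suc n))"
    using sc it by (simp add: step_cond_def pfw_iteration_def)
  finally show ?thesis .
qed

text \<open>
  The truncation condition says \<open>L * norm d ^ 2 \<le> g\<close>, so the quadratic term of the descent lemma
  consumes at most half of the slope \<open>g\<close>. The linear term uses the exact gradient and costs another \<open>\<epsilon>\<close>.
\<close>

lemma full_fw_step_decrease:
  assumes it: "pfw_iteration a q G R T n" and x: "iter T n \<in> C"
    and gap: "\<theta> < inexact_fw_gap a G T n"
    and full: "dir T n = fw_dir a T n" "step T n = 1"
    and long: "1 \<le> slope G T n / (L * (norm (dir T n))\<^sup>2)"
  shows "\<delta> < f (iter T n) - f (iter T (Suc n))"
proof -
  let ?x = "iter T n" and ?d = "fw_dir a T n"
  have "0 < norm ?d"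
    using gap \<theta> by auto
  then have "0 < L * (norm ?d)\<^sup>2"
    using L(1) by simp
  then have "L * (norm ?d)\<^sup>2 \<le> - (G ?x \<bullet> ?d)"
    using long unfolding slope_def full by (metis mult_1 pos_le_divide_eq)
  moreover have "f (iter T (Suc n)) \<le> f ?x + gradf ?x \<bullet> ?d + L / 2 * (norm ?d)\<^sup>2"
    using descent_lemma[OF grad L(2), of ?x ?d] it full by (simp add: pfw_iteration_def)
  moreover have "\<bar>(gradf ?x - G ?x) \<bullet> ?d\<bar> \<le> \<epsilon>"
    using inexact[OF x vertex_in_C] it
    by (auto simp: fw_dir_def pfw_iteration_def is_arg_min_linorder)
  ultimately have "\<theta> / 2 - \<epsilon> < f ?x - f (iter T (Suc n))"
    using gap by (simp add: inner_diff_left)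
  then show ?thesis by (simp add: \<delta>_def)
qed

lemma step_monotone:
  assumes sc: "step_cond f L \<rho> G T n" and it: "pfw_iteration a q G R T n"
    and "0 \<le> slope G T n" "0 \<le> max_step T n"
  shows "f (iter T (Suc n)) \<le> f (iter T n)"
proof -
  have "0 \<le> step_lower L G T n"
    using assms(3,4) L by (simp add: step_lower_def)
  then have "0 \<le> \<rho> * step_lower L G T n * slope G T n"
    using \<rho> assms(3) by simp
  then show ?thesis using sc it by (simp add: step_cond_def pfw_iteration_def)
qed

lemma state_preserved:
  assumes st: "convex_state a q T n" and it: "pfw_iteration a q G R T n"
  shows "convex_state a q T (Suc n)" and "swap_count T (Suc n) \<le> R"
proof -
  let ?i = "fw_index T n" and ?j = "away_index T n"
  have i: "?i \<le> q" and jS: "?j \<in> support q T n" and j: "?j \<le> q"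
    using it by (auto simp: pfw_iteration_def is_arg_min_linorder is_arg_max_linorder support_def)
  have next_iter: "iter T (Suc n) = iter T n + step T n *\<^sub>R dir T n"
    using it by (simp add: pfw_iteration_def)
  have "convex_state a q T (Suc n) \<and> swap_count T (Suc n) \<le> R"
    using it
  proof (cases rule: pfw_iteration_cases)
    case pairwise
    have "convex_state a q T (Suc n)"
      by (rule convex_state_update[OF st i j pairwise(5)])
         (use pairwise(1,2) in \<open>auto simp: next_iter pairwise(3) algebra_simps\<close>)
    then show ?thesis using pairwise by simp
  next
    case fw
    have "convex_state a q T (Suc n)"
      by (rule convex_state_update[OF st i j fw(5)])
         (use fw(1,2) jS in \<open>auto simp: next_iter fw(3) fw_dir_def algebra_simps support_def\<close>)
    then show ?thesis using fw by simp
  next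
    case away
    let ?w = "weight T n ?j"
    \<comment> \<open>Weight one would make the maximal step a division by zero, that is zero, but the step is positive.\<close>
    have "?w < 1"
      using weight_le_1[OF st jS] away(1,2,4) by (cases "?w = 1") auto
    then have "step T n \<le> (1 + step T n) * ?w"
      using away(2,4) by (simp add: le_divide_eq algebra_simps)
    then have "convex_state a q T (Suc n)"
      by (intro convex_state_update[OF st j j away(6)])
         (use away(1) in \<open>auto simp: next_iter away(3) away_dir_def algebra_simps\<close>)
    then show ?thesis using away by simp
  qed
  then show "convex_state a q T (Suc n)" and "swap_count T (Suc n) \<le> R" by auto
qed

text \<open>
  The three alternatives are a productive iteration, a drop and a swap. If the iteration is not
  productive, its step is maximal and the away vertex leaves the support. An away step brings in no
  new vertex, so it is a drop. A pairwise step is a drop if the Frank-Wolfe vertex is already active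
  and a swap otherwise. A maximal Frank-Wolfe step is always productive.
\<close>

lemma iteration_progress:
  assumes st: "convex_state a q T n" and it: "pfw_iteration a q G R T n"
    and sc: "step_cond f L \<rho> G T n" and gap: "\<theta> < inexact_fw_gap a G T n"
  shows "f (iter T (Suc n)) \<le> f (iter T n)"
    and "\<delta> < f (iter T n) - f (iter T (Suc n)) \<and> active (Suc n) \<le> active n + 1 \<or>
      active (Suc n) < active n \<or>
      active (Suc n) \<le> active n \<and> 2 \<le> active n \<and> swap_count T (Suc n) = Suc (swap_count T n)"
    (is "?good \<or> ?drop \<or> ?swap")
proof -
  let ?x = "iter T n" and ?i = "fw_index T n" and ?j = "away_index T n" and ?S = "support q T n"
  let ?w = "weight T n ?j" and ?g = "slope G T n"
  let ?len = "?g / (L * (norm (dir T n))\<^sup>2)"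
  have i: "?i \<le> q" and jS: "?j \<in> ?S" and j: "?j \<le> q"
    and jmax: "\<And>k. k \<in> ?S \<Longrightarrow> G ?x \<bullet> a k \<le> G ?x \<bullet> a ?j"
    using it by (auto simp: pfw_iteration_def is_arg_min_linorder is_arg_max_linorder support_def)
  have w: "0 < ?w" using jS by (simp add: support_def)
  have xC: "?x \<in> C" using convex_state_in_hull[OF st] .
  have away_nonneg: "G ?x \<bullet> ?x \<le> G ?x \<bullet> a ?j"
    by (rule iter_inner_le_away[OF st jmax])
  have lower: "step_lower L G T n \<le> step T n"
    using sc by (simp add: step_cond_def)
  have card_insert: "card (insert ?i B) \<le> card B + 1" if "finite B" for B
    using that by (simp add: card_insert_if)
  have card_le: "active (Suc n) \<le> card B" if "support q T (Suc n) \<subseteq> B" "finite B" for B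
    using that by (simp add: card_mono)
  have "f (iter T (Suc n)) \<le> f ?x \<and> (?good \<or> ?drop \<or> ?swap)"
    using it
  proof (cases rule: pfw_iteration_cases)
    case pairwise
    \<comment> \<open>The pairwise slope is the inexact gap plus the away slope, and the latter is nonnegative.\<close>
    have g: "\<theta> < ?g"
      using pairwise(3) gap away_nonneg by (simp add: slope_def fw_dir_def inner_diff_right)
    have mono: "f (iter T (Suc n)) \<le> f ?x"
      using step_monotone[OF sc it] g \<theta> pairwise(4) w by simp
    have sub: "support q T (Suc n) \<subseteq> insert ?i ?S"
      by (rule support_update[OF st _ pairwise(5)]) (use pairwise(1) in simp)
    have grow: "active (Suc n) \<le> active n + 1"
      using card_le[OF sub] card_insert[of ?S] by fastforce
    \<comment> \<open>Equal indices would give the zero direction, with slope zero.\<close>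
    have neq: "?i \<noteq> ?j"
      using g \<theta> pairwise(3) by (auto simp: slope_def)
    show ?thesis
    proof (cases "?len \<le> max_step T n")
      case True
      have "norm (dir T n) \<le> \<Delta>"
        unfolding pairwise(3) by (intro norm_le_diam vertex_in_C i j)
      then have ?good
        using short_step_decrease[OF sc it g _ True] grow by blast
      then show ?thesis using mono by blast
    next
      case False
      then have full: "step T n = ?w"
        using lower pairwise(2,4) by (simp add: step_lower_def)
      have "?j \<notin> support q T (Suc n)"
        using pairwise(5)[OF j] neq full by (simp add: support_def)
      then have sub': "support q T (Suc n) \<subseteq> insert ?i (?S - {?j})"
        using sub by auto
      have shrink: "active (Suc n) \<le> card (insert ?i (?S - {?j}))"
        by (rule card_le[OF sub']) simp
      have card_minus: "Suc (card (?S - {?j})) = active n"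
        using jS by (rule card.remove[symmetric, OF finite_support])
      consider "?i \<in> ?S" | "?i \<notin> ?S" "2 \<le> active n" | "active n \<le> 1"
        by fastforce
      then show ?thesis
      proof cases
        case 1
        then have "insert ?i (?S - {?j}) = ?S - {?j}" using neq by auto
        with shrink have "active (Suc n) \<le> card (?S - {?j})" by metis
        then have ?drop
          using card_minus by linarith
        then show ?thesis using mono by blast
      next
        case 2
        have "active (Suc n) \<le> active n"
          using shrink card_minus card_insert[of "?S - {?j}"] by fastforce
        then have ?swap using 2 pairwise(6) full by presburger
        then show ?thesis using mono by blast
      next
        case 3
        \<comment> \<open>At a vertex the away direction vanishes, so the pairwise step is a full Frank-Wolfe step.\<close>
        have vertex: "?w = 1" "?x = a ?j"
          using singleton_support[OF st jS 3] by auto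
        have "dir T n = fw_dir a T n"
          using vertex(2) pairwise(3) by (simp add: fw_dir_def)
        moreover have "step T n = 1"
          using full vertex(1) by simp
        moreover have "1 \<le> ?len"
          using False pairwise(4) vertex(1) by linarith
        ultimately have "\<delta> < f ?x - f (iter T (Suc n))"
          by (rule full_fw_step_decrease[OF it xC gap])
        then show ?thesis using grow mono by blast
      qed
    qed
  next
    case fw
    have g: "\<theta> < ?g"
      using fw(3) gap by (simp add: slope_def)
    have mono: "f (iter T (Suc n)) \<le> f ?x"
      using step_monotone[OF sc it] g \<theta> fw(4) by simp
    have sub: "support q T (Suc n) \<subseteq> insert ?i ?S"
      by (rule support_update[OF st _ fw(5)]) auto
    have grow: "active (Suc n) \<le> active n + 1"
      using card_le[OF sub] card_insert[of ?S] by fastforce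
    have "\<delta> < f ?x - f (iter T (Suc n))"
    proof (cases "?len \<le> max_step T n")
      case True
      have "norm (dir T n) \<le> \<Delta>"
        using fw(3) norm_le_diam[OF vertex_in_C[OF i] xC] by (simp add: fw_dir_def)
      then show ?thesis
        by (rule short_step_decrease[OF sc it g _ True])
    next
      case False
      then have "step T n = 1" "1 \<le> ?len"
        using lower fw(2,4) by (simp_all add: step_lower_def)
      then show ?thesis
        by (rule full_fw_step_decrease[OF it xC gap fw(3)])
    qed
    then show ?thesis using grow mono by blast
  next
    case away
    have g: "\<theta> < ?g"
      using away(3,5) gap by (simp add: slope_def)
    have mono: "f (iter T (Suc n)) \<le> f ?x"
      using step_monotone[OF sc it] g \<theta> away(1,2) by simp
    have "support q T (Suc n) \<subseteq> insert ?j ?S"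
      by (rule support_update[OF st _ away(6)]) (use away(1) in simp)
    then have sub: "support q T (Suc n) \<subseteq> ?S"
      using jS by auto
    show ?thesis
    proof (cases "?len \<le> max_step T n")
      case True
      have "norm (dir T n) \<le> \<Delta>"
        using away(3) norm_le_diam[OF xC vertex_in_C[OF j]] by (simp add: away_dir_def)
      then have ?good
        using short_step_decrease[OF sc it g _ True] le_SucI[OF card_le[OF sub finite_support]] by simp
      then show ?thesis using mono by blast
    next
      case False
      then have full: "step T n = ?w / (1 - ?w)"
        using lower away(2,4) by (simp add: step_lower_def)
      moreover have "1 - ?w \<noteq> 0"
        using full away(1) by (metis division_ring_divide_zero less_irrefl)
      ultimately have "step T n * (1 - ?w) = ?w"
        by (rule nonzero_eq_divide_eq[THEN iffD1, rotated])
      moreover have "weight T (Suc n) ?j = ?w - step T n * (1 - ?w)"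
        by (simp add: away(6)[OF j] algebra_simps)
      ultimately have "weight T (Suc n) ?j = 0"
        by linarith
      then have "?j \<notin> support q T (Suc n)"
        by (simp add: support_def)
      then have "support q T (Suc n) \<subset> ?S"
        using sub jS by blast
      then have ?drop by (intro psubset_card_mono finite_support)
      then show ?thesis using mono by blast
    qed
  qed
  then show "f (iter T (Suc n)) \<le> f (iter T n)" and "?good \<or> ?drop \<or> ?swap" by blast+
qed

section \<open>Counting iterations\<close>

text \<open>
  Iterations performed plus remaining budget never exceed \<open>2 * (R + 1)\<close> times the decrease of \<open>f\<close> in
  units of \<open>\<delta>\<close>. The inequality becomes strict with the first iteration: the run starts at a vertex,
  where the iteration is productive, and a productive iteration decreases \<open>f\<close> by strictly more
  than \<open>\<delta>\<close>.
\<close>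

lemma potential_bound:
  assumes "\<And>n. n < k \<Longrightarrow> pfw_iteration a q G R T n"
    and "\<And>n. n < k \<Longrightarrow> step_cond f L \<rho> G T n"
    and "\<And>n. n < k \<Longrightarrow> \<theta> < inexact_fw_gap a G T n"
  shows "convex_state a q T k \<and> swap_count T k \<le> R \<and>
    real k + bad_budget R (active k) (swap_count T k)
      \<le> 2 * (real R + 1) * ((f (iter T 0) - f (iter T k)) / \<delta>) \<and>
    (0 < k \<longrightarrow> real k + bad_budget R (active k) (swap_count T k)
      < 2 * (real R + 1) * ((f (iter T 0) - f (iter T k)) / \<delta>))" (is "?inv k")
  using assms
proof (induction k)
  case 0
  have "swap_count T 0 = 0" using init by (simp add: pfw_init_def)
  then show ?case
    using convex_state_init[OF init] card_support_init[OF init] by (simp add: bad_budget_def)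
next
  case (Suc k)
  let ?B = "\<lambda>n. bad_budget R (active n) (swap_count T n)"
  let ?P = "\<lambda>n. 2 * (real R + 1) * ((f (iter T 0) - f (iter T n)) / \<delta>)"
  have "?inv k"
    by (rule Suc.IH; rule Suc.prems; simp)
  then have st: "convex_state a q T k" and r: "swap_count T k \<le> R"
    and IH: "real k + ?B k \<le> ?P k" "0 < k \<Longrightarrow> real k + ?B k < ?P k"
    by blast+
  have it: "pfw_iteration a q G R T k"
    using Suc.prems(1) by simp
  note next_state = state_preserved[OF st it]
  have "step_cond f L \<rho> G T k" "\<theta> < inexact_fw_gap a G T k"
    by (rule Suc.prems; simp)+
  note progress = iteration_progress[OF st it this]
  have s: "1 \<le> active k" "1 \<le> active (Suc k)"
    using card_support_pos st next_state by blast+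
  have P_step: "?P (Suc k) = ?P k + 2 * (real R + 1) * ((f (iter T k) - f (iter T (Suc k))) / \<delta>)"
    by (simp add: diff_divide_distrib flip: distrib_left)
  have strict: "real (Suc k) + ?B (Suc k) < ?P (Suc k)"
    using progress(2)
  proof (elim disjE conjE)
    assume dec: "\<delta> < f (iter T k) - f (iter T (Suc k))" and s': "active (Suc k) \<le> active k + 1"
    have "1 < (f (iter T k) - f (iter T (Suc k))) / \<delta>"
      using dec \<delta>_pos by simp
    then have "2 * (real R + 1) * 1 < 2 * (real R + 1) * ((f (iter T k) - f (iter T (Suc k))) / \<delta>)"
      by (intro mult_strict_left_mono) auto
    then show ?thesis
      using bad_budget_good[OF s(1) s' r, of "swap_count T (Suc k)"] IH(1) P_step by linarith
  next
    assume *: "active (Suc k) < active k"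
    \<comment> \<open>With a single initial vertex the first iteration cannot be a drop, so strictness is inherited.\<close>
    have "0 < k"
      using * s card_support_init[OF init] by (cases "k = 0") auto
    moreover have "0 \<le> 2 * (real R + 1) * ((f (iter T k) - f (iter T (Suc k))) / \<delta>)"
      using progress(1) \<delta>_pos by simp
    ultimately show ?thesis
      using bad_budget_drop[OF s(2) * r, of "swap_count T (Suc k)"] IH(2) P_step by linarith
  next
    assume *: "active (Suc k) \<le> active k" "2 \<le> active k"
      "swap_count T (Suc k) = Suc (swap_count T k)"
    have "0 < k"
      using * card_support_init[OF init] by (cases "k = 0") auto
    moreover have "0 \<le> 2 * (real R + 1) * ((f (iter T k) - f (iter T (Suc k))) / \<delta>)"
      using progress(1) \<delta>_pos by simp
    moreover have "?B (Suc k) + 1 \<le> ?B k"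
      using bad_budget_swap[OF *(1,2)] *(3) next_state(2) by simp
    ultimately show ?thesis
      using IH(2) P_step by linarith
  qed
  show ?case using next_state strict less_imp_le[OF strict] by blast
qed

lemma iteration_bound:
  assumes "0 < k"
    and "\<And>n. n < k \<Longrightarrow> pfw_iteration a q G R T n"
    and "\<And>n. n < k \<Longrightarrow> step_cond f L \<rho> G T n"
    and "\<And>n. n < k \<Longrightarrow> \<theta> < inexact_fw_gap a G T n"
    and low: "\<And>x. x \<in> C \<Longrightarrow> m \<le> f x"
  shows "real k < 2 * (real R + 1) * ((f (iter T 0) - m) / \<delta>)"
proof -
  have pot: "convex_state a q T k" "swap_count T k \<le> R"
    "real k + bad_budget R (active k) (swap_count T k)
      < 2 * (real R + 1) * ((f (iter T 0) - f (iter T k)) / \<delta>)"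
    using potential_bound[OF assms(2-4)] assms(1) by blast+
  have "real k < 2 * (real R + 1) * ((f (iter T 0) - f (iter T k)) / \<delta>)"
    using pot(3) bad_budget_nonneg[OF pot(2), of "active k"] by linarith
  also have "\<dots> \<le> 2 * (real R + 1) * ((f (iter T 0) - m) / \<delta>)"
    using low[OF convex_state_in_hull[OF pot(1)]] \<delta>_pos
    by (intro mult_left_mono divide_right_mono) auto
  finally show ?thesis .
qed

lemma iter_in_C:
  assumes "\<And>n. n < k \<Longrightarrow> pfw_iteration a q G R T n"
  shows "iter T k \<in> C"
proof -
  have "convex_state a q T k"
    using assms by (induction k) (auto intro: convex_state_init[OF init] state_preserved(1))
  then show ?thesis by (rule convex_state_in_hull)
qed

end

lemma pfw_last_exists:
  assumes "\<not> pfw_performed a G \<tau> T k"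
  obtains N where "pfw_last a G \<tau> T N"
proof -
  obtain m where "pfw_stop a G \<tau> T m"
    using assms by (auto simp: pfw_performed_def)
  then have "pfw_last a G \<tau> T (LEAST m. pfw_stop a G \<tau> T m)"
    unfolding pfw_last_def pfw_performed_def using LeastI not_less_Least by metis
  then show thesis by (rule that)
qed

section \<open>Termination and the Frank-Wolfe gap\<close>

theorem theorem3p7:
  fixes a :: "nat \<Rightarrow> real ^ 'd" and q R :: nat
    and C :: "(real ^ 'd) set"
    and f :: "real ^ 'd \<Rightarrow> real"
    and gradf G :: "real ^ 'd \<Rightarrow> real ^ 'd"
    and \<Delta> L \<tau> \<sigma> \<rho> fstar \<alpha>1 \<alpha>2 :: real
    and T :: "(real ^ 'd) pfw_trace"
  assumes "C = convex hull (a ` {0..q})"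
    and "\<Delta> = diameter C" and "\<Delta> > 0"
    and "\<And>x. GDERIV f x :> gradf x"
    and "L > 0" and "L-lipschitz_on UNIV gradf"
    and "fstar = (INF x\<in>C. f x)"
    and "\<tau> > 0" and "0 \<le> \<sigma>" and "\<sigma> < 1 / 3"
    and "\<And>y x. y \<in> C \<Longrightarrow> x \<in> C \<Longrightarrow> \<bar>(gradf y - G y) \<bullet> (x - y)\<bar> \<le> \<sigma> / (1 + \<sigma>) * \<tau>"
    and "pfw_run a q G \<tau> R T"
    and "\<rho> > 0"
    and "\<And>n. pfw_performed a G \<tau> T n \<Longrightarrow> step_cond f L \<rho> G T n"
    and "\<alpha>1 = \<Delta>\<^sup>2 * L * (f (iter T 0) - fstar) * (1 + \<sigma>)\<^sup>2 / (\<tau>\<^sup>2 * \<rho> * (1 - \<sigma>)\<^sup>2)"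
    and "\<alpha>2 = 2 * (f (iter T 0) - fstar) * (1 + \<sigma>) / (\<tau> * (1 - 3 * \<sigma>))"
  shows "(\<exists>N. pfw_last a G \<tau> T N \<and>
            (f (iter T 0) \<noteq> fstar \<longrightarrow> int N \<le> \<lceil>2 * (real R + 1) * max \<alpha>1 \<alpha>2\<rceil> - 1) \<and>
            (f (iter T 0) = fstar \<longrightarrow> N = 0) \<and>
            best_fw_gap C gradf T N \<le> \<tau> * (1 + 2 * \<sigma>) / (1 + \<sigma>)) \<and>
         (\<forall>K. (\<forall>n\<le>K. pfw_iteration a q G R T n \<and> step_cond f L \<rho> G T n) \<and>
              \<lceil>2 * (real R + 1) * max \<alpha>1 \<alpha>2\<rceil> - 1 \<le> int K \<longrightarrow>
              best_fw_gap C gradf T K \<le> \<tau> / (1 + \<sigma>))"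
proof -
  define \<epsilon> where "\<epsilon> = \<sigma> / (1 + \<sigma>) * \<tau>"
  \<comment> \<open>An exact gap above \<open>\<tau> / (1 + \<sigma>)\<close> forces the inexact gap above \<open>\<theta>\<close>.\<close>
  define \<theta> where "\<theta> = \<tau> / (1 + \<sigma>) - \<epsilon>"
  note \<sigma> = assms(9,10) and \<tau> = assms(8)
  have \<theta>_eq: "\<theta> = \<tau> * (1 - \<sigma>) / (1 + \<sigma>)"
    by (simp add: \<theta>_def \<epsilon>_def right_diff_distrib diff_divide_distrib)
  have nz: "1 + \<sigma> \<noteq> 0"
    using \<sigma> by simp
  have half: "\<theta> / 2 - \<epsilon> = \<tau> * (1 - 3 * \<sigma>) / (2 * (1 + \<sigma>))"
    using nz unfolding \<theta>_eq \<epsilon>_def by (simp add: divide_simps) (simp add: algebra_simps)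
  have "0 < \<tau> * (1 - 3 * \<sigma>) / (2 * (1 + \<sigma>))"
    using \<sigma> \<tau> by simp
  then have gap_margin: "2 * \<epsilon> < \<theta>"
    using half by linarith
  have \<theta>_pos: "0 < \<theta>"
    using \<sigma> \<tau> by (simp add: \<theta>_eq)
  have init: "pfw_init a q T" and iterations: "\<And>n. pfw_performed a G \<tau> T n \<Longrightarrow> pfw_iteration a q G R T n"
    using assms(12) by (auto simp: pfw_run_def)
  interpret inexact_pfw a q R f gradf G \<Delta> L \<rho> \<epsilon> \<theta> T
    using assms(2-6,11,13) init gap_margin \<theta>_pos
    by unfold_locales (auto simp: assms(1) \<epsilon>_def)
  note C_eq = assms(1)

  have "continuous_on C f"
    using assms(4) unfolding gderiv_def
    by (blast intro: continuous_at_imp_continuous_on has_derivative_continuous)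
  then have "bdd_below (f ` C)"
    using compact_C C_eq by (metis bounded_imp_bdd_below compact_continuous_image compact_imp_bounded)
  then have fstar_le: "fstar \<le> f x" if "x \<in> convex hull (a ` {0..q})" for x
    using that by (auto simp: assms(7) C_eq intro: cINF_lower)

  define X where "X = 2 * (real R + 1) * max \<alpha>1 \<alpha>2"
  have gap0: "0 \<le> f (iter T 0) - fstar"
    using fstar_le iter_in_C[of 0] by simp
  have \<alpha>1: "\<alpha>1 = (f (iter T 0) - fstar) / (\<rho> * \<theta>\<^sup>2 / (L * \<Delta>\<^sup>2))"
    unfolding assms(15) \<theta>_eq power_divide power_mult_distrib by (simp add: ac_simps)
  have \<alpha>2: "\<alpha>2 = (f (iter T 0) - fstar) / (\<theta> / 2 - \<epsilon>)"
    unfolding assms(16) half by (simp add: algebra_simps)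
  have X_eq: "X = 2 * (real R + 1) * ((f (iter T 0) - fstar) / \<delta>)"
  proof -
    have pos: "0 < \<rho> * \<theta>\<^sup>2 / (L * \<Delta>\<^sup>2)" "0 < \<theta> / 2 - \<epsilon>"
      using \<rho> \<theta> L diam by auto
    have max_divide: "max (c / u) (c / v) = c / min u v" if "0 \<le> c" "0 < u" "0 < v" for c u v :: real
      using that by (cases "u \<le> v") (auto simp: max_def min_def frac_le divide_left_mono antisym)
    show ?thesis
      by (simp only: X_def \<alpha>1 \<alpha>2 \<delta>_def max_divide[OF gap0 pos])
  qed

  have bound: "real k < X"
    if "0 < k" "\<And>n. n < k \<Longrightarrow> pfw_iteration a q G R T n"
      "\<And>n. n < k \<Longrightarrow> step_cond f L \<rho> G T n" "\<And>n. n < k \<Longrightarrow> \<theta> < inexact_fw_gap a G T n" for k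
    unfolding X_eq by (rule iteration_bound[OF that fstar_le])

  have "\<theta> \<le> \<tau>"
    using \<sigma> \<tau> by (simp add: \<theta>_eq field_simps)
  have run_bound: "real k < X" if "0 < k" and run: "pfw_performed a G \<tau> T k" for k
  proof (rule bound[OF that(1)])
    fix n assume "n < k"
    then have "pfw_performed a G \<tau> T n" and "\<not> pfw_stop a G \<tau> T n"
      using run by (auto simp: pfw_performed_def)
    then show "pfw_iteration a q G R T n" "step_cond f L \<rho> G T n"
      "\<theta> < inexact_fw_gap a G T n"
      using iterations assms(14) \<open>\<theta> \<le> \<tau>\<close> by (auto simp: pfw_stop_def)
  qed

  have "\<exists>k. \<not> pfw_performed a G \<tau> T k"
  proof -
    obtain k :: nat where "X < real k" using reals_Archimedean2 by blast
    then have "X < real (Suc k)" by simp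
    then show ?thesis using run_bound[of "Suc k"] by force
  qed
  then obtain N where last: "pfw_last a G \<tau> T N"
    using pfw_last_exists by metis
  then have performed: "pfw_performed a G \<tau> T N" and stop: "pfw_stop a G \<tau> T N"
    by (auto simp: pfw_last_def)
  have "int N \<le> \<lceil>X\<rceil> - 1" if "f (iter T 0) \<noteq> fstar"
  proof -
    have "0 < X"
      using that gap0 \<delta>_pos by (simp add: X_eq)
    then have "real N < X"
      using run_bound[OF _ performed] by (cases "N = 0") auto
    then show ?thesis
      by (simp add: less_ceiling_iff zle_diff1_eq)
  qed
  moreover have "N = 0" if "f (iter T 0) = fstar"
    using run_bound[OF _ performed] that by (cases "N = 0") (auto simp: X_eq)
  moreover have "best_fw_gap C gradf T N \<le> \<tau> * (1 + 2 * \<sigma>) / (1 + \<sigma>)"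
  proof -
    have "pfw_iteration a q G R T n" if "n \<le> N" for n
      using performed that by (intro iterations) (auto simp: pfw_performed_def)
    then have "fw_gap C gradf (iter T N) \<le> inexact_fw_gap a G T N + \<epsilon>"
      unfolding C_eq by (intro fw_gap_le_inexact_fw_gap iter_in_C) auto
    also have "\<dots> \<le> \<tau> + \<epsilon>"
      using stop by (simp add: pfw_stop_def)
    also have "\<dots> = \<tau> * (1 + 2 * \<sigma>) / (1 + \<sigma>)"
      using \<sigma> by (simp add: \<epsilon>_def field_simps)
    finally have "fw_gap C gradf (iter T N) \<le> \<tau> * (1 + 2 * \<sigma>) / (1 + \<sigma>)" .
    moreover have "best_fw_gap C gradf T N \<le> fw_gap C gradf (iter T N)"
      unfolding best_fw_gap_def by (intro Min_le) auto
    ultimately show ?thesis by linarith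
  qed
  moreover have "best_fw_gap C gradf T K \<le> \<tau> / (1 + \<sigma>)"
    if K: "\<forall>n\<le>K. pfw_iteration a q G R T n \<and> step_cond f L \<rho> G T n" "\<lceil>X\<rceil> - 1 \<le> int K" for K
  proof (rule ccontr)
    assume "\<not> ?thesis"
    then have best: "\<tau> / (1 + \<sigma>) < best_fw_gap C gradf T K" by simp
    have large: "\<tau> / (1 + \<sigma>) < fw_gap C gradf (iter T n)" if "n \<le> K" for n
    proof -
      have "best_fw_gap C gradf T K \<le> fw_gap C gradf (iter T n)"
        unfolding best_fw_gap_def using that by (intro Min_le) auto
      then show ?thesis using best by linarith
    qed
    have "real (Suc K) < X"
    proof (rule bound)
      fix n assume "n < Suc K"
      then have "n \<le> K" by simp
      then have "fw_gap C gradf (iter T n) \<le> inexact_fw_gap a G T n + \<epsilon>"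
        unfolding C_eq using K(1) by (intro fw_gap_le_inexact_fw_gap iter_in_C) auto
      then show "\<theta> < inexact_fw_gap a G T n"
        using large[OF \<open>n \<le> K\<close>] by (simp add: \<theta>_def)
      show "pfw_iteration a q G R T n" "step_cond f L \<rho> G T n"
        using K(1) \<open>n \<le> K\<close> by auto
    qed simp
    then show False using K(2) by linarith
  qed
  ultimately show ?thesis
    using last unfolding X_def by blast
qed

end
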